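(* Let $q$ be a prime power and $n\ge 1$. Let $\mathrm{psd}_2(n)$ be the number of symmetric matrices $A\in M_n(\mathbb{F}_q)$ such that $A=LL^T$ for some lower triangular matrix $L\in M_n(\mathbb{F}_q)$ whose diagonal entries are all nonnegative. Then $$\mathrm{psd}_2(n)\le\begin{cases}\displaystyle 2\prod_{i=1}^n\left(1+\frac{q^i}{2}\right) & \text{if } q\equiv 3\pmod 4,\\[1.2em] \displaystyle \prod_{i=1}^n\left(1+\frac{q^i}{4}\right) & \text{if } q\equiv 1\pmod 4,\\[1.2em] \displaystyle q^{\frac{n(n-1)}{2}}(q+1)^n & \text{if } q \text{ is even}.\end{cases}$$
   Context: An element $a\in\mathbb{F}_q^\times$ is positive if $a=b^2$ for some $b\in\mathbb{F}_q^\times$. An element of $\mathbb{F}_q$ is nonnegative if it is positive or zero. *)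

theory Defs
  imports
    "Jordan_Normal_Form.Matrix"
    "HOL-Library.Cardinality"
begin

text \<open>
  A finite type of class \<^class>\<open>field\<close> plays the role of the finite field with
  \<open>q = CARD('a)\<close> elements.
\<close>

definition ff_positive :: "'a::{field,finite} \<Rightarrow> bool" where
  "ff_positive a \<longleftrightarrow> a \<noteq> 0 \<and> (\<exists>b. b \<noteq> 0 \<and> a = b ^ 2)"

definition ff_nonnegative :: "'a::{field,finite} \<Rightarrow> bool" where
  "ff_nonnegative a \<longleftrightarrow> ff_positive a \<or> a = 0"

definition lower_triangular :: "'a::zero mat \<Rightarrow> bool" where
  "lower_triangular L \<longleftrightarrow> (\<forall>i < dim_row L. \<forall>j < dim_col L. i < j \<longrightarrow> L $$ (i, j) = 0)"

definition psd2_matrices :: "nat \<Rightarrow> 'a::{field,finite} mat set" where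
  "psd2_matrices n = {A \<in> carrier_mat n n. A\<^sup>T = A \<and>
     (\<exists>L \<in> carrier_mat n n. lower_triangular L \<and>
        (\<forall>i < n. ff_nonnegative (L $$ (i, i))) \<and> A = L * L\<^sup>T)}"

definition psd2 :: "'a::{field,finite} itself \<Rightarrow> nat \<Rightarrow> nat" where
  "psd2 _ n = card (psd2_matrices n :: 'a mat set)"

text \<open>
  Since \<^const>\<open>card\<close> is \<open>0\<close> on infinite sets, finiteness is checked, so that
  \<^const>\<open>psd2\<close> is a true count.
\<close>

lemma finite_psd2_matrices: "finite (psd2_matrices n :: 'a::{field,finite} mat set)"
proof -
  let ?I = "{..<n} \<times> {..<n}"
  have "(psd2_matrices n :: 'a mat set) \<subseteq> mat n n ` (?I \<rightarrow>\<^sub>E UNIV)"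
  proof
    fix A :: "'a mat"
    assume "A \<in> psd2_matrices n"
    then have "A \<in> carrier_mat n n"
      by (simp add: psd2_matrices_def)
    then have "A = mat n n (restrict (\<lambda>ij. A $$ ij) ?I)"
      by (intro eq_matI) auto
    moreover have "restrict (\<lambda>ij. A $$ ij) ?I \<in> ?I \<rightarrow>\<^sub>E UNIV"
      by (rule restrict_PiE_iff[THEN iffD2]) simp
    ultimately show "A \<in> mat n n ` (?I \<rightarrow>\<^sub>E UNIV)"
      by (rule image_eqI)
  qed
  then show ?thesis
    by (rule finite_subset) (intro finite_imageI finite_PiE; simp)
qed

end

theory Submission
  imports Defs "HOL-Computational_Algebra.Polynomial"
begin

text \<open>
  Write \<open>A = L L\<^sup>T\<close> and split on the corner entry \<open>l\<close> of \<open>L\<close>. If \<open>l \<noteq> 0\<close>, then \<open>l\<^sup>2\<close> is a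
  nonzero fourth power and \<open>A\<close> is determined by \<open>l\<^sup>2\<close>, the rest of its first column and a
  Schur complement of the same kind. If \<open>l = 0\<close>, then the first row and column of \<open>A\<close> vanish,
  and it is enough to count the remaining block as a symmetric matrix. With \<open>s\<close> the number of
  nonzero fourth powers this gives
  \<open>psd\<^sub>2(n + 1) \<le> s q\<^sup>n psd\<^sub>2(n) + q\<^bsup>n(n + 1)/2\<^esup>\<close>.
  The map \<open>b \<mapsto> b\<^sup>4\<close> is at least two-to-one on units for odd \<open>q\<close>, and four-to-one for
  \<open>q \<equiv> 1\<close> modulo 4, where \<open>-1\<close> is a square; the bounds follow by induction on \<open>n\<close>.
\<close>

section \<open>Fourth powers in a finite field\<close>

lemma card_image_times_le:
  assumes "finite U" and fib: "\<And>x. x \<in> U \<Longrightarrow> k \<le> card {y \<in> U. f y = f x}"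
  shows "k * card (f ` U) \<le> card U"
proof -
  have "card U = (\<Sum>y\<in>f ` U. card {x \<in> U. f x = y})"
    using sum.image_gen[OF assms(1), of "\<lambda>_. 1::nat" f] by simp
  also have "\<dots> \<ge> (\<Sum>y\<in>f ` U. k)"
    by (intro sum_mono) (use fib in auto)
  finally show ?thesis by (simp add: mult.commute)
qed

text \<open>Right multiplication by a unit \<open>x\<close> is injective and carries
  \<open>G\<close> into the fibre of \<open>f\<close> through \<open>x\<close>, so every fibre on
  the units has at least \<open>card G\<close> elements.\<close>

lemma card_image_times_le_stabilizer:
  fixes f :: "'a::{field,finite} \<Rightarrow> 'b"
  assumes "0 \<notin> G" and inv: "\<And>g x. g \<in> G \<Longrightarrow> f (g * x) = f x"
  shows "card G * card (f ` (- {0})) \<le> CARD('a) - 1"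
proof -
  have "card G * card (f ` (- {0})) \<le> card (- {0::'a})"
  proof (rule card_image_times_le)
    fix x :: 'a assume "x \<in> - {0}"
    then have "card G = card ((\<lambda>g. g * x) ` G)"
      by (intro card_image[symmetric] inj_onI) simp
    also have "\<dots> \<le> card {y \<in> - {0}. f y = f x}"
      using assms \<open>x \<in> - {0}\<close> by (intro card_mono) auto
    finally show "card G \<le> card {y \<in> - {0}. f y = f x}" .
  qed simp
  then show ?thesis by (simp add: card_Diff_singleton Compl_eq_Diff_UNIV)
qed

text \<open>If 1 + 1 = 0, then x -> x + 1 is an involution without fixed points; its orbits split
  the field into pairs and force an even cardinality.\<close>

lemma two_neq_zero_if_odd_card:
  assumes "odd CARD('a::{field,finite})"
  shows "(1::'a) + 1 \<noteq> 0"
proof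
  assume two: "(1::'a) + 1 = 0"
  have add2: "x + 1 + 1 = x" for x :: 'a
    using two by (metis add.assoc add.right_neutral)
  have "2 * card (range (\<lambda>x::'a. {x, x + 1})) = CARD('a)"
  proof -
    have "card (\<Union> (range (\<lambda>x::'a. {x, x + 1}))) = 2 * card (range (\<lambda>x::'a. {x, x + 1}))"
    proof (subst card_Union_disjoint)
      show "pairwise disjnt (range (\<lambda>x::'a. {x, x + 1}))"
      proof (rule pairwiseI)
        fix A B :: "'a set"
        assume "A \<in> range (\<lambda>x. {x, x + 1})" "B \<in> range (\<lambda>x. {x, x + 1})" "A \<noteq> B"
        then obtain x y where "A = {x, x + 1}" "B = {y, y + 1}" by blast
        with \<open>A \<noteq> B\<close> show "disjnt A B"
          using add2[of x] add2[of y] by (auto simp: disjnt_def)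
      qed
      have "(\<Sum>A\<in>range (\<lambda>x::'a. {x, x + 1}). card A) = (\<Sum>A\<in>range (\<lambda>x::'a. {x, x + 1}). 2)"
        by (intro sum.cong) auto
      then show "(\<Sum>A\<in>range (\<lambda>x::'a. {x, x + 1}). card A) = 2 * card (range (\<lambda>x::'a. {x, x + 1}))"
        by simp
    qed auto
    moreover have "\<Union> (range (\<lambda>x::'a. {x, x + 1})) = UNIV" by auto
    ultimately show ?thesis by simp
  qed
  with assms show False by (metis dvd_triv_left)
qed

text \<open>Multiplication by \<open>b\<close> permutes the units and so preserves their product,
  which is nonzero and cancels.\<close>

lemma power_card_minus_one:
  fixes b :: "'a::{field,finite}"
  assumes "b \<noteq> 0"
  shows "b ^ (CARD('a) - 1) = 1"
proof -
  let ?P = "\<Prod>x\<in>- {0::'a}. x"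
  have "bij_betw ((*) b) (- {0}) (- {0})"
    using assms by (intro bij_betwI[where g = "\<lambda>x. x / b"]) auto
  then have "?P = (\<Prod>x\<in>- {0}. b * x)"
    by (rule prod.reindex_bij_betw[symmetric])
  also have "\<dots> = b ^ (CARD('a) - 1) * ?P"
    by (simp add: prod.distrib card_Diff_singleton Compl_eq_Diff_UNIV)
  finally show ?thesis by simp
qed

text \<open>With q = 4m + 1, the polynomial X^(2m) - 1 has too few roots to vanish at all 4m units.
  For a unit b that is not a root, b^(2m) is a square root of 1 other than 1, hence -1, and b^m is
  the witness.\<close>

lemma ex_sqrt_minus_one:
  assumes "CARD('a::{field,finite}) mod 4 = 1"
  shows "\<exists>i::'a. i ^ 2 = -1"
proof -
  obtain m where q: "CARD('a) = 4 * m + 1"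
    using assms by (metis mod_div_decomp mult.commute)
  have "m > 0"
    using q card_mono[of "UNIV::'a set" "{0, 1}"] by (cases m) auto
  define p :: "'a poly" where "p = monom 1 (2 * m) - 1"
  \<comment> \<open>Positivity of \<open>m\<close> keeps the constant term -1 away from this
    coefficient.\<close>
  have "coeff p (2 * m) = 1"
    using \<open>m > 0\<close> by (simp add: p_def)
  then have "p \<noteq> 0" by auto
  have "degree p \<le> 2 * m"
    unfolding p_def by (intro degree_diff_le) (auto intro: degree_monom_le)
  then have "card {x. poly p x = 0} \<le> 2 * m"
    using card_poly_roots_bound[OF \<open>p \<noteq> 0\<close>] by linarith
  moreover have "card (- {0::'a}) = 4 * m"
    using q by (simp add: card_Diff_singleton Compl_eq_Diff_UNIV)
  ultimately have "\<not> - {0} \<subseteq> {x. poly p x = 0}"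
    using \<open>m > 0\<close> card_mono[of "{x. poly p x = 0}" "- {0}"] by auto
  then obtain b :: 'a where b: "b \<noteq> 0" "b ^ (2 * m) \<noteq> 1"
    by (auto simp: p_def poly_monom)
  have "(b ^ (2 * m)) ^ 2 = 1"
    using power_card_minus_one[OF b(1)] q by (simp flip: power_mult add: mult.commute)
  with b(2) have "b ^ (2 * m) = -1" by (simp add: power2_eq_1_iff)
  then show ?thesis
    by (intro exI[of _ "b ^ m"]) (simp flip: power_mult add: mult.commute)
qed

text \<open>Zero is left out: these are the possible corner entries l^2 of \<open>A\<close> when l =
  b^2 is nonzero.\<close>

abbreviation fourth_powers :: "'a::{field,finite} set" where
  "fourth_powers \<equiv> (\<lambda>b. b ^ 4) ` (- {0})"

lemma card_fourth_powers_odd: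
  assumes "odd CARD('a::{field,finite})"
  shows "2 * card (fourth_powers :: 'a set) \<le> CARD('a) - 1"
proof -
  have "(1::'a) \<noteq> -1"
    using two_neq_zero_if_odd_card[OF assms] by (metis add.right_inverse)
  then have "card {1, -1 :: 'a} = 2" by simp
  moreover have "card {1, -1 :: 'a} * card (fourth_powers :: 'a set) \<le> CARD('a) - 1"
    by (rule card_image_times_le_stabilizer) auto
  ultimately show ?thesis by simp
qed

text \<open>The multipliers are the fourth roots of unity 1, -1, i, -i; most of the work is to show
  them distinct.\<close>

lemma card_fourth_powers_1_mod_4:
  assumes "CARD('a::{field,finite}) mod 4 = 1"
  shows "4 * card (fourth_powers :: 'a set) \<le> CARD('a) - 1"
proof -
  have "odd CARD('a)" using assms by presburger
  then have ne: "(1::'a) \<noteq> -1"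
    using two_neq_zero_if_odd_card by (metis add.right_inverse)
  obtain i :: 'a where i: "i ^ 2 = -1" using ex_sqrt_minus_one[OF assms] by blast
  have i4: "i ^ 4 = 1"
    using i power_mult[of i 2 2] by simp
  have "i \<noteq> 0" using i by auto
  moreover have "i \<noteq> 1" "i \<noteq> -1" using i ne by auto
  moreover have "i \<noteq> -i"
  proof
    assume "i = -i"
    then have "i * (1 + 1) = 0" by (metis add.right_inverse distrib_left mult.right_neutral)
    then show False using \<open>i \<noteq> 0\<close> \<open>odd CARD('a)\<close> two_neq_zero_if_odd_card by auto
  qed
  ultimately have "card {1, -1, i, -i} = 4"
    using ne by (auto simp: card_insert_if equation_minus_iff minus_equation_iff)
  moreover have "card {1, -1, i, -i} * card (fourth_powers :: 'a set) \<le> CARD('a) - 1"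
    using \<open>i \<noteq> 0\<close> i4 by (intro card_image_times_le_stabilizer) (auto simp: power_mult_distrib)
  ultimately show ?thesis by simp
qed

section \<open>Splitting off the first row and column\<close>

text \<open>The size is read off \<open>v\<close>, and only the entries of \<open>B\<close> with
  both indices below \<open>dim_vec v\<close> enter.\<close>

definition bordered :: "'a \<Rightarrow> 'a vec \<Rightarrow> 'a mat \<Rightarrow> 'a mat" where
  "bordered a v B = mat (Suc (dim_vec v)) (Suc (dim_vec v)) (\<lambda>(i, j).
     case i of 0 \<Rightarrow> (case j of 0 \<Rightarrow> a | Suc j' \<Rightarrow> v $ j')
     | Suc i' \<Rightarrow> (case j of 0 \<Rightarrow> v $ i' | Suc j' \<Rightarrow> B $$ (i', j')))"

definition sym_mats :: "nat \<Rightarrow> 'a mat set" where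
  "sym_mats n = {A \<in> carrier_mat n n. A\<^sup>T = A}"

lemma sym_matsD:
  assumes "A \<in> sym_mats n" "i < n" "j < n"
  shows "A $$ (i, j) = A $$ (j, i)"
  using assms by (metis (mono_tags, lifting) carrier_matD index_transpose_mat(1) mem_Collect_eq sym_mats_def)

text \<open>Symmetry of \<open>A\<close> supplies the first row from the first column.\<close>

lemma bordered_eqI:
  assumes "A \<in> sym_mats (Suc n)" "v \<in> carrier_vec n"
    and "A $$ (0, 0) = a" "\<And>i. i < n \<Longrightarrow> A $$ (Suc i, 0) = v $ i"
    and "\<And>i j. i < n \<Longrightarrow> j < n \<Longrightarrow> A $$ (Suc i, Suc j) = B $$ (i, j)"
  shows "A = bordered a v B"
proof (rule eq_matI)
  fix i j assume "i < dim_row (bordered a v B)" "j < dim_col (bordered a v B)"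
  then have "i < Suc n" "j < Suc n" using assms(2) by (auto simp: bordered_def)
  then show "A $$ (i, j) = bordered a v B $$ (i, j)"
    using assms sym_matsD[OF assms(1), of i j]
    by (auto simp: bordered_def split: nat.split)
qed (use assms in \<open>auto simp: bordered_def sym_mats_def\<close>)

section \<open>Counting vectors and symmetric matrices\<close>

lemma card_carrier_vec:
  "finite (carrier_vec n :: 'a::finite vec set)"
  "card (carrier_vec n :: 'a::finite vec set) \<le> CARD('a) ^ n"
proof -
  have sub: "(carrier_vec n :: 'a vec set) \<subseteq> vec n ` ({..<n} \<rightarrow>\<^sub>E UNIV)"
  proof
    fix v :: "'a vec" assume "v \<in> carrier_vec n"
    then have "v = vec n (restrict (($) v) {..<n})" by auto
    then show "v \<in> vec n ` ({..<n} \<rightarrow>\<^sub>E UNIV)"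
      by (intro image_eqI[where x = "restrict (($) v) {..<n}"]) auto
  qed
  have fin: "finite ({..<n} \<rightarrow>\<^sub>E (UNIV :: 'a set))" by (intro finite_PiE) auto
  show "finite (carrier_vec n :: 'a vec set)"
    using sub fin by (meson finite_imageI finite_subset)
  show "card (carrier_vec n :: 'a vec set) \<le> CARD('a) ^ n"
    using surj_card_le[OF fin sub] by (simp add: card_PiE)
qed

lemma sym_mats_Suc_subset:
  "(sym_mats (Suc n) :: 'a mat set) \<subseteq>
     (\<lambda>(a, v, B). bordered a v B) ` (UNIV \<times> carrier_vec n \<times> sym_mats n)"
proof
  fix A :: "'a mat" assume A: "A \<in> sym_mats (Suc n)"
  let ?v = "vec n (\<lambda>i. A $$ (Suc i, 0))"
  let ?B = "mat n n (\<lambda>(i, j). A $$ (Suc i, Suc j))"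
  have "?B \<in> sym_mats n"
    unfolding sym_mats_def using sym_matsD[OF A] by auto
  moreover have "A = bordered (A $$ (0, 0)) ?v ?B"
    using A by (intro bordered_eqI) auto
  ultimately show "A \<in> (\<lambda>(a, v, B). bordered a v B) ` (UNIV \<times> carrier_vec n \<times> sym_mats n)"
    by (intro image_eqI[where x = "(A $$ (0, 0), ?v, ?B)"]) auto
qed

text \<open>Corner and border contribute n + 1 free entries, which leads from one triangular
  exponent to the next. Finiteness is carried through the induction because the bound on the size of
  an image asks for a finite domain.\<close>

lemma card_sym_mats:
  "finite (sym_mats n :: 'a::finite mat set) \<and>
   card (sym_mats n :: 'a mat set) \<le> CARD('a) ^ (n * (n + 1) div 2)"
proof (induction n)
  case 0
  \<comment> \<open>The entry function is never evaluated; the type has no zero with which to write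
    a zero matrix.\<close>
  let ?Z = "mat 0 0 (\<lambda>_. undefined) :: 'a mat"
  have "(sym_mats 0 :: 'a mat set) \<subseteq> {?Z}" by (auto simp: sym_mats_def)
  then show ?case
    using card_mono[of "{?Z}" "sym_mats 0 :: 'a mat set"] finite_subset by auto
next
  case (Suc n)
  have fin: "finite ((UNIV :: 'a set) \<times> (carrier_vec n :: 'a vec set) \<times> (sym_mats n :: 'a mat set))"
    using Suc by (intro finite_cartesian_product card_carrier_vec) auto
  have "card (sym_mats (Suc n) :: 'a mat set) \<le>
      CARD('a) * (card (carrier_vec n :: 'a vec set) * card (sym_mats n :: 'a mat set))"
    using surj_card_le[OF fin sym_mats_Suc_subset] by (simp add: card_cartesian_product)
  also have "\<dots> \<le> CARD('a) * (CARD('a) ^ n * CARD('a) ^ (n * (n + 1) div 2))"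
    using Suc card_carrier_vec by (intro mult_left_mono mult_mono) auto
  also have "\<dots> = CARD('a) ^ (Suc n + n * (n + 1) div 2)"
    by (simp add: power_add)
  also have "Suc n + n * (n + 1) div 2 = Suc n * (Suc n + 1) div 2" by simp
  finally show ?case
    using finite_subset[OF sym_mats_Suc_subset finite_imageI[OF fin]] by simp
qed

section \<open>The recurrence for the counts\<close>

text \<open>Let L have corner l, first column w below it, and remaining block M. Then A has corner
  l^2, border l w and block w w^T + M M^T. For nonzero l, put s = l^2 and v = l w: the block is v
  v^T / s plus the Schur complement M M^T, which is again of the counted kind.\<close>

lemma psd2_matrices_Suc_subset:
  "(psd2_matrices (Suc n) :: 'a::{field,finite} mat set) \<subseteq>
     (\<lambda>(s, v, C). bordered s v (mat n n (\<lambda>(i, j). v $ i * v $ j / s + C $$ (i, j)))) `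
       (fourth_powers \<times> carrier_vec n \<times> psd2_matrices n) \<union>
     bordered 0 (0\<^sub>v n) ` sym_mats n" (is "_ \<subseteq> ?F ` _ \<union> _")
proof
  fix A :: "'a mat" assume "A \<in> psd2_matrices (Suc n)"
  then obtain L where A: "A \<in> sym_mats (Suc n)" and L: "L \<in> carrier_mat (Suc n) (Suc n)"
    and low: "lower_triangular L" and diag: "\<And>i. i < Suc n \<Longrightarrow> ff_nonnegative (L $$ (i, i))"
    and AL: "A = L * L\<^sup>T"
    unfolding psd2_matrices_def sym_mats_def by blast
  define M where "M = mat n n (\<lambda>(i, j). L $$ (Suc i, Suc j))"
  define l where "l = L $$ (0, 0)"
  let ?w = "\<lambda>i. L $$ (Suc i, 0)"
  have MM: "(M * M\<^sup>T) $$ (i, j) = (\<Sum>k<n. L $$ (Suc i, Suc k) * L $$ (Suc j, Suc k))"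
    if "i < n" "j < n" for i j
    using that by (simp add: M_def scalar_prod_def lessThan_atLeast0)
  have sum: "A $$ (i, j) = L $$ (i, 0) * L $$ (j, 0) + (\<Sum>k<n. L $$ (i, Suc k) * L $$ (j, Suc k))"
    if "i < Suc n" "j < Suc n" for i j
  proof -
    have "A $$ (i, j) = (\<Sum>k<Suc n. L $$ (i, k) * L $$ (j, k))"
      using that L by (simp add: AL scalar_prod_def lessThan_atLeast0)
    then show ?thesis by (simp only: sum.lessThan_Suc_shift)
  qed
  have L0: "L $$ (0, Suc k) = 0" if "k < n" for k
    using low L that by (auto simp: lower_triangular_def)
  \<comment> \<open>In row 0 or column 0 of \<open>A\<close> the sum over \<open>k\<close> vanishes
    by \<open>L0\<close>, and only the term from column 0 of \<open>L\<close> is left.\<close>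
  have A00: "A $$ (0, 0) = l * l" and Ai0: "\<And>i. i < n \<Longrightarrow> A $$ (Suc i, 0) = ?w i * l"
    and Aij: "\<And>i j. i < n \<Longrightarrow> j < n \<Longrightarrow> A $$ (Suc i, Suc j) = ?w i * ?w j + (M * M\<^sup>T) $$ (i, j)"
    using L0 by (simp_all add: sum MM l_def)
  show "A \<in> ?F ` (fourth_powers \<times> carrier_vec n \<times> psd2_matrices n) \<union>
      bordered 0 (0\<^sub>v n) ` sym_mats n"
  proof (cases "l = 0")
    case True
    let ?B = "mat n n (\<lambda>(i, j). A $$ (Suc i, Suc j))"
    have "?B \<in> sym_mats n"
      unfolding sym_mats_def using sym_matsD[OF A] by auto
    moreover have "A = bordered 0 (0\<^sub>v n) ?B"
      using A True A00 Ai0 by (intro bordered_eqI) auto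
    ultimately show ?thesis by blast
  next
    case False
    let ?v = "vec n (\<lambda>i. ?w i * l)"
    \<comment> \<open>Nonnegativity of the diagonal makes l itself a square, so l^2 is a fourth
      power and not merely a square.\<close>
    obtain b where "b \<noteq> 0" "l = b ^ 2"
      using diag[of 0] False by (auto simp: l_def ff_nonnegative_def ff_positive_def)
    then have "l * l \<in> fourth_powers"
      by (auto simp flip: power_add)
    moreover have "M * M\<^sup>T \<in> psd2_matrices n"
    proof -
      have "M \<in> carrier_mat n n" by (simp add: M_def)
      moreover from this have "(M * M\<^sup>T)\<^sup>T = M * M\<^sup>T"
        by (subst transpose_mult[where nr = n and n = n and nc = n]) auto
      moreover have "lower_triangular M"
        using low L by (auto simp: lower_triangular_def M_def)
      moreover have "\<forall>i<n. ff_nonnegative (M $$ (i, i))"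
        using diag by (simp add: M_def)
      ultimately show ?thesis unfolding psd2_matrices_def by auto
    qed
    \<comment> \<open>Division by l * l turns (w_i l)(w_j l) back into w_i w_j.\<close>
    moreover have "A = ?F (l * l, ?v, M * M\<^sup>T)"
      unfolding prod.case using A A00 Ai0 Aij False by (intro bordered_eqI) auto
    ultimately show ?thesis by (intro UnI1 image_eqI[where x = "(l * l, ?v, M * M\<^sup>T)"] SigmaI) auto
  qed
qed

lemma psd2_Suc_le:
  "psd2 TYPE('a::{field,finite}) (Suc n) \<le>
     card (fourth_powers :: 'a set) * CARD('a) ^ n * psd2 TYPE('a) n + CARD('a) ^ (n * (n + 1) div 2)"
proof -
  let ?D = "(fourth_powers :: 'a set) \<times> (carrier_vec n :: 'a vec set) \<times> (psd2_matrices n :: 'a mat set)"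
  let ?F = "\<lambda>(s, v, C). bordered s v (mat n n (\<lambda>(i, j). v $ i * v $ j / s + C $$ (i, j)))"
  let ?S = "sym_mats n :: 'a mat set"
  have fin: "finite ?D"
    by (intro finite_cartesian_product card_carrier_vec finite_psd2_matrices) simp
  have "psd2 TYPE('a) (Suc n) \<le> card (?F ` ?D \<union> bordered 0 (0\<^sub>v n) ` ?S)"
    unfolding psd2_def using fin card_sym_mats psd2_matrices_Suc_subset
    by (intro card_mono) auto
  also have "\<dots> \<le> card (?F ` ?D) + card (bordered 0 (0\<^sub>v n) ` ?S)"
    by (rule card_Un_le)
  also have "\<dots> \<le> card ?D + card ?S"
    using fin card_sym_mats by (intro add_mono card_image_le) auto
  also have "card ?D = card (fourth_powers :: 'a set) * card (carrier_vec n :: 'a vec set) * psd2 TYPE('a) n"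
    by (simp add: card_cartesian_product psd2_def)
  also have "\<dots> \<le> card (fourth_powers :: 'a set) * CARD('a) ^ n * psd2 TYPE('a) n"
    using card_carrier_vec by (intro mult_right_mono mult_left_mono) auto
  finally show ?thesis using card_sym_mats[where 'a = 'a and n = n] by linarith
qed

lemma psd2_0: "psd2 TYPE('a::{field,finite}) 0 \<le> 1"
proof -
  have "(psd2_matrices 0 :: 'a mat set) \<subseteq> {0\<^sub>m 0 0}" by (auto simp: psd2_matrices_def)
  then show ?thesis
    unfolding psd2_def using card_mono[of "{0\<^sub>m 0 0}" "psd2_matrices 0 :: 'a mat set"] by auto
qed

section \<open>Solving the recurrence\<close>

lemma triangle_Suc: "Suc n * (Suc n + 1) div 2 = n * (n + 1) div 2 + Suc n"
  by simp

text \<open>Since (q - 1) q^n / c + (1 + q^n / c) = 1 + q^(n+1) / c, the induction closes as soon as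
  the additive term is at most (1 + q^n / c) times the bound for n; this is
  \<open>gap\<close>.\<close>

lemma recurrence_prod_bound:
  fixes f :: "nat \<Rightarrow> real" and c K q :: real
  assumes rec: "\<And>n. f (Suc n) \<le> (q - 1) / c * q ^ n * f n + q ^ (n * (n + 1) div 2)"
    and "f 0 \<le> K" "q \<ge> 1" "c > 0"
    and gap: "\<And>n. q ^ (n * (n + 1) div 2) \<le> (1 + q ^ n / c) * (K * (\<Prod>i = 1..n. (1 + q ^ i / c)))"
  shows "f n \<le> K * (\<Prod>i = 1..n. (1 + q ^ i / c))"
proof (induction n)
  case 0
  then show ?case using assms by simp
next
  case (Suc n)
  let ?P = "K * (\<Prod>i = 1..n. (1 + q ^ i / c))"
  have "f (Suc n) \<le> (q - 1) / c * q ^ n * f n + q ^ (n * (n + 1) div 2)" by (rule rec)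
  also have "\<dots> \<le> (q - 1) / c * q ^ n * ?P + (1 + q ^ n / c) * ?P"
    using assms Suc by (intro add_mono mult_left_mono gap) auto
  also have "\<dots> = ?P * (1 + q ^ Suc n / c)"
    using \<open>c > 0\<close> by (simp add: field_simps)
  also have "\<dots> = K * (\<Prod>i = 1..Suc n. (1 + q ^ i / c))" by simp
  finally show ?case .
qed

lemma prod_one_plus_ge:
  fixes q c :: real
  assumes "q \<ge> 0" "c > 0"
  shows "q ^ (n * (n + 1) div 2) / c ^ n \<le> (\<Prod>i = 1..n. (1 + q ^ i / c))"
proof (induction n)
  case (Suc n)
  have "q ^ (Suc n * (Suc n + 1) div 2) / c ^ Suc n =
      q ^ (n * (n + 1) div 2) / c ^ n * (q ^ Suc n / c)"
    by (simp only: triangle_Suc power_add) simp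
  also have "\<dots> \<le> (\<Prod>i = 1..n. (1 + q ^ i / c)) * (1 + q ^ Suc n / c)"
    using assms by (intro mult_mono Suc) (auto intro!: prod_nonneg)
  finally show ?case by simp
qed simp

text \<open>Dropping the 1 from each factor bounds the product below by q^(n(n+1)/2) / c^n, so
  \<open>gap\<close> reduces to a comparison of c^n with (1 + q^n / c) K.\<close>

lemma gap_from_prod:
  fixes q c K :: real
  assumes "q > 0" "c > 0" "K \<ge> 0" "c ^ n \<le> (1 + q ^ n / c) * K"
  shows "q ^ (n * (n + 1) div 2) \<le> (1 + q ^ n / c) * (K * (\<Prod>i = 1..n. (1 + q ^ i / c)))"
proof -
  have "q ^ (n * (n + 1) div 2) = c ^ n * (q ^ (n * (n + 1) div 2) / c ^ n)"
    using assms by simp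
  also have "\<dots> \<le> (1 + q ^ n / c) * K * (\<Prod>i = 1..n. (1 + q ^ i / c))"
    using assms by (intro mult_mono prod_one_plus_ge) auto
  finally show ?thesis by (simp add: mult.assoc)
qed

lemma recurrence_bound_3_mod_4:
  fixes f :: "nat \<Rightarrow> real" and q :: real
  assumes "\<And>n. f (Suc n) \<le> (q - 1) / 2 * q ^ n * f n + q ^ (n * (n + 1) div 2)"
    and "f 0 \<le> 1" "q \<ge> 3"
  shows "f n \<le> 2 * (\<Prod>i = 1..n. (1 + q ^ i / 2))"
proof (rule recurrence_prod_bound)
  fix n
  \<comment> \<open>With c = K = 2 the condition reads 2^n \<le> 2 + q^n.\<close>
  have "2 ^ n \<le> q ^ n" using assms by (intro power_mono) auto
  then show "q ^ (n * (n + 1) div 2) \<le> (1 + q ^ n / 2) * (2 * (\<Prod>i = 1..n. (1 + q ^ i / 2)))"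
    using assms by (intro gap_from_prod) auto
qed (use assms in auto)

lemma recurrence_bound_1_mod_4:
  fixes f :: "nat \<Rightarrow> real" and q :: real
  assumes "\<And>n. f (Suc n) \<le> (q - 1) / 4 * q ^ n * f n + q ^ (n * (n + 1) div 2)"
    and "f 0 \<le> 1" "q \<ge> 9"
  shows "f n \<le> (\<Prod>i = 1..n. (1 + q ^ i / 4))"
proof -
  have "f n \<le> 1 * (\<Prod>i = 1..n. (1 + q ^ i / 4))"
  proof (rule recurrence_prod_bound)
    fix n :: nat
    consider "n = 0" | "n = 1" | m where "n = Suc (Suc m)" by (metis One_nat_def not0_implies_Suc)
    then show "q ^ (n * (n + 1) div 2) \<le> (1 + q ^ n / 4) * (1 * (\<Prod>i = 1..n. (1 + q ^ i / 4)))"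
    proof cases
      case 2
      \<comment> \<open>At n = 1 the criterion of \<open>gap_from_prod\<close> fails for q = 9, so
        \<open>gap\<close> is checked directly: (1 + q/4)^2 - q = (1 - q/4)^2.\<close>
      have "0 \<le> (1 - q / 4)\<^sup>2" by simp
      then have "q \<le> (1 + q / 4) * (1 + q / 4)" by (simp add: power2_eq_square field_simps)
      then show ?thesis using 2 by simp
    next
      case 3
      \<comment> \<open>The left side is 4^(n+1); the inequality 4^(n+1) \<le> 9^n starts to hold at
        n = 2, where it says 64 \<le> 81.\<close>
      have "16 * 4 ^ m * 4 \<le> 81 * (9::real) ^ m"
        using mult_mono[of "64::real" 81 "4 ^ m" "9 ^ m"] power_mono[of "4::real" 9 m] by simp
      also have "\<dots> = 9 ^ n" by (simp add: 3)
      also have "\<dots> \<le> q ^ n" using assms by (intro power_mono) auto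
      finally have "4 ^ n \<le> (1 + q ^ n / 4) * 1" by (simp add: 3)
      then show ?thesis using assms by (intro gap_from_prod) auto
    qed (use assms in auto)
  qed (use assms in auto)
  then show ?thesis by simp
qed

text \<open>
  For \<open>q = 5\<close> the inductive step of the product bound fails at \<open>n = 3\<close>, so the recurrence is
  first solved exactly.
\<close>

lemma recurrence_bound_5:
  fixes f :: "nat \<Rightarrow> real"
  assumes rec: "\<And>n. f (Suc n) \<le> 5 ^ n * f n + 5 ^ (n * (n + 1) div 2)" and "f 0 \<le> 1"
  shows "f n \<le> (\<Prod>i = 1..n. (1 + 5 ^ i / 4))"
proof -
  \<comment> \<open>The quotient f(n) / 5^(n(n-1)/2) starts at no more than 1 and grows by at most 1
    in each step.\<close>
  have f: "f (Suc n) \<le> (real n + 2) * 5 ^ (n * (n + 1) div 2)" for n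
  proof (induction n)
    case 0
    then show ?case using assms rec[of 0] by simp
  next
    case (Suc n)
    have "f (Suc (Suc n)) \<le> 5 ^ Suc n * f (Suc n) + 5 ^ (Suc n * (Suc n + 1) div 2)" by (rule rec)
    also have "\<dots> \<le> 5 ^ Suc n * ((real n + 2) * 5 ^ (n * (n + 1) div 2)) + 5 ^ (Suc n * (Suc n + 1) div 2)"
      using Suc by (intro add_right_mono mult_left_mono) auto
    also have "\<dots> = (real (Suc n) + 2) * 5 ^ (Suc n * (Suc n + 1) div 2)"
      by (simp only: triangle_Suc power_add) (simp add: algebra_simps)
    finally show ?case .
  qed
  \<comment> \<open>This compares the bound \<open>f\<close> at index N = n + 4 with the product.
    The base case is 78125 against 21177801/256; afterwards 5(N + 1)/4 \<ge> N + 2 makes the new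
    factor large enough.\<close>
  have large: "(real n + 5) * 5 ^ ((n + 3) * (n + 4) div 2) \<le> (\<Prod>i = 1..n + 4. (1 + (5::real) ^ i / 4))" for n
  proof (induction n)
    case 0
    have "{1..4} = {1, 2, 3, 4 :: nat}" by auto
    then show ?case by simp
  next
    case (Suc n)
    have tri: "(Suc n + 3) * (Suc n + 4) div 2 = (n + 3) * (n + 4) div 2 + (n + 4)"
      using triangle_Suc[of "n + 3"] by (simp add: algebra_simps)
    have "(real (Suc n) + 5) * 5 ^ ((Suc n + 3) * (Suc n + 4) div 2) =
      (real n + 6) * 5 ^ (n + 4) * (5 ^ ((n + 3) * (n + 4) div 2))"
      by (simp only: tri power_add) simp
    also have "\<dots> \<le> (real n + 5) * 5 ^ ((n + 3) * (n + 4) div 2) * (1 + 5 ^ Suc (n + 4) / 4)"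
    proof -
      have "(real n + 5) * (1 + 5 ^ Suc (n + 4) / 4) - (real n + 6) * 5 ^ (n + 4) =
          real n + 5 + (real n + 1) * 5 ^ (n + 4) / 4"
        unfolding power_Suc by (simp add: field_simps)
      moreover have "0 \<le> real n + 5 + (real n + 1) * 5 ^ (n + 4) / 4" by simp
      ultimately have "(real n + 6) * 5 ^ (n + 4) \<le> (real n + 5) * (1 + 5 ^ Suc (n + 4) / 4)"
        by linarith
      then have "(real n + 6) * 5 ^ (n + 4) * 5 ^ ((n + 3) * (n + 4) div 2)
          \<le> (real n + 5) * (1 + 5 ^ Suc (n + 4) / 4) * 5 ^ ((n + 3) * (n + 4) div 2)"
        by (rule mult_right_mono) simp
      then show ?thesis by (simp only: mult_ac)
    qed
    also have "\<dots> \<le> (\<Prod>i = 1..n + 4. (1 + (5::real) ^ i / 4)) * (1 + 5 ^ Suc (n + 4) / 4)"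
      using Suc by (intro mult_right_mono) auto
    also have "\<dots> = (\<Prod>i = 1..Suc n + 4. (1 + (5::real) ^ i / 4))"
      unfolding add_Suc by (subst prod.nat_ivl_Suc') (simp_all add: mult.commute)
    finally show ?case .
  qed
  \<comment> \<open>The cases below 4 are numerical; the one for n = 3 is 500 against
    33669/64.\<close>
  consider "n = 0" | "n = 1" | "n = 2" | "n = 3" | m where "n = m + 4"
  proof -
    have "n = 0 \<or> n = 1 \<or> n = 2 \<or> n = 3 \<or> n = n - 4 + 4" by presburger
    then show thesis using that by metis
  qed
  then show ?thesis
  proof cases
    case 5
    then show ?thesis using f[of "m + 3"] large[of m] by (simp add: algebra_simps)
  next
    case 4
    have "{1..3} = {1, 2, 3 :: nat}" by auto
    then show ?thesis using 4 f[of 2] by (simp add: numeral_3_eq_3[symmetric])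
  qed (use f[of 0] f[of 1] assms(2) in \<open>simp_all add: eval_nat_numeral\<close>)
qed

lemma recurrence_bound_even:
  fixes f :: "nat \<Rightarrow> real" and q :: real
  assumes rec: "\<And>n. f (Suc n) \<le> (q - 1) * q ^ n * f n + q ^ (n * (n + 1) div 2)"
    and "f 0 \<le> 1" "q \<ge> 1"
  shows "f n \<le> q ^ (n * (n - 1) div 2) * (q + 1) ^ n"
proof (induction n)
  case (Suc n)
  let ?t = "n * (n - 1) div 2"
  have tri: "n * (n + 1) div 2 = n + ?t"
    by (cases n) (auto simp: triangle_Suc)
  have "f (Suc n) \<le> (q - 1) * q ^ n * f n + q ^ (n * (n + 1) div 2) * 1"
    using rec[of n] by simp
  also have "\<dots> \<le> (q - 1) * q ^ n * (q ^ ?t * (q + 1) ^ n) + q ^ (n * (n + 1) div 2) * 1"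
    using assms by (intro add_right_mono mult_left_mono Suc) auto
  \<comment> \<open>The coefficient 2 is chosen so that (q - 1) + 2 = q + 1 produces the next power
    of q + 1.\<close>
  also have "\<dots> \<le> (q - 1) * q ^ n * (q ^ ?t * (q + 1) ^ n) + q ^ (n * (n + 1) div 2) * (2 * (q + 1) ^ n)"
  proof (intro add_left_mono mult_left_mono)
    have "1 \<le> (q + 1) ^ n" using assms by (intro one_le_power) simp
    then show "1 \<le> 2 * (q + 1) ^ n" by linarith
  qed (use assms in auto)
  also have "\<dots> = q ^ (n * (n + 1) div 2) * (q + 1) ^ Suc n"
    by (simp only: tri power_add) (simp add: algebra_simps)
  finally show ?case by (simp add: mult.commute)
qed (use assms in auto)

section \<open>From the real recurrence to the three bounds\<close>

lemma psd2_recurrence: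
  fixes c :: real
  assumes "c > 0" "c * card (fourth_powers :: 'a::{field,finite} set) \<le> real CARD('a) - 1"
  shows "real (psd2 TYPE('a) (Suc n)) \<le>
    (real CARD('a) - 1) / c * real CARD('a) ^ n * real (psd2 TYPE('a) n) +
    real CARD('a) ^ (n * (n + 1) div 2)"
proof -
  have "real (psd2 TYPE('a) (Suc n)) \<le>
      card (fourth_powers :: 'a set) * real CARD('a) ^ n * real (psd2 TYPE('a) n) +
      real CARD('a) ^ (n * (n + 1) div 2)"
    using of_nat_mono[OF psd2_Suc_le[where 'a = 'a and n = n], where 'a = real]
    by (simp only: of_nat_add of_nat_mult of_nat_power)
  also have "\<dots> \<le> (real CARD('a) - 1) / c * real CARD('a) ^ n * real (psd2 TYPE('a) n) +
      real CARD('a) ^ (n * (n + 1) div 2)"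
    using assms by (intro add_right_mono mult_right_mono) (auto simp: field_simps)
  finally show ?thesis .
qed

theorem theorem4p9:
  fixes q n :: nat
  assumes "CARD('a::{field,finite}) = q" and "n \<ge> 1"
  shows "(q mod 4 = 3 \<longrightarrow>
            real (psd2 TYPE('a) n) \<le> 2 * (\<Prod>i = 1..n. (1 + real q ^ i / 2)))
       \<and> (q mod 4 = 1 \<longrightarrow>
            real (psd2 TYPE('a) n) \<le> (\<Prod>i = 1..n. (1 + real q ^ i / 4)))
       \<and> (even q \<longrightarrow>
            real (psd2 TYPE('a) n) \<le> real q ^ (n * (n - 1) div 2) * (real q + 1) ^ n)"
proof (intro conjI impI)
  note rec = psd2_recurrence[where 'a = 'a, unfolded assms(1)]
  have f0: "real (psd2 TYPE('a) 0) \<le> 1" using psd2_0[where 'a = 'a] by simp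
  have q2: "q \<ge> 2"
    using assms card_mono[of "UNIV::'a set" "{0, 1}"] by simp
  show "real (psd2 TYPE('a) n) \<le> 2 * (\<Prod>i = 1..n. (1 + real q ^ i / 2))" if "q mod 4 = 3"
  proof (rule recurrence_bound_3_mod_4)
    have "q \<ge> 3" "odd q" using that by presburger+
    then show "real q \<ge> 3" by simp
    show "real (psd2 TYPE('a) (Suc n)) \<le>
        (real q - 1) / 2 * real q ^ n * real (psd2 TYPE('a) n) + real q ^ (n * (n + 1) div 2)" for n
      using card_fourth_powers_odd[where 'a = 'a] \<open>odd q\<close> q2 assms(1)
      by (intro rec) auto
  qed (rule f0)
  show "real (psd2 TYPE('a) n) \<le> (\<Prod>i = 1..n. (1 + real q ^ i / 4))" if "q mod 4 = 1"
  proof -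
    have rec4: "real (psd2 TYPE('a) (Suc n)) \<le>
        (real q - 1) / 4 * real q ^ n * real (psd2 TYPE('a) n) + real q ^ (n * (n + 1) div 2)" for n
      using card_fourth_powers_1_mod_4[where 'a = 'a] that q2 assms(1)
      by (intro rec) auto
    \<comment> \<open>The bound \<open>q2\<close> excludes q = 1, and the next residue after 5 is
      9.\<close>
    have "q = 5 \<or> q \<ge> 9" using that q2 by presburger
    then show ?thesis
    proof
      assume "q = 5"
      then show ?thesis using recurrence_bound_5[of "\<lambda>n. real (psd2 TYPE('a) n)"] rec4 f0 by simp
    next
      assume "q \<ge> 9"
      then show ?thesis
        by (intro recurrence_bound_1_mod_4[where f = "\<lambda>n. real (psd2 TYPE('a) n)"] rec4 f0) simp
    qed
  qed
  show "real (psd2 TYPE('a) n) \<le> real q ^ (n * (n - 1) div 2) * (real q + 1) ^ n"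
  proof (rule recurrence_bound_even)
    \<comment> \<open>The trivial bound, c = 1, is sharp here: squaring is injective in
      characteristic 2, so every unit is a fourth power.\<close>
    have "card (fourth_powers :: 'a set) \<le> card (- {0::'a})" by (rule card_image_le) simp
    then have "card (fourth_powers :: 'a set) \<le> q - 1"
      using assms(1) by (simp add: card_Diff_singleton Compl_eq_Diff_UNIV)
    then show "real (psd2 TYPE('a) (Suc n)) \<le>
        (real q - 1) * real q ^ n * real (psd2 TYPE('a) n) + real q ^ (n * (n + 1) div 2)" for n
      using rec[of 1 n] q2 by auto
  qed (use f0 q2 in auto)
qed

end
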